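(* Let $C$ be an $n$-dimensional Gaussian copula with correlation matrix $R$ such that $\det R\ne0$. Then for all $\lambda_1,\dots,\lambda_n>0$ the limit defining the weak lower tail dependence function $\chi$ of $C$ exists and $$\chi(\lambda_1,\dots,\lambda_n)=\max_i\lambda_i\ \min_{w\in\Delta_n}w^\top\Sigma w,$$ where $\Sigma$ is the $n\times n$ matrix with entries $\Sigma_{ij}=\frac{R_{ij}}{\sqrt{\lambda_i\lambda_j}}$, $1\le i,j\le n$.
   Context: The Gaussian copula with correlation matrix $R$ is the unique copula of any Gaussian vector with correlation matrix $R$ and nonconstant components; here the copula of a vector $(Y_1,\dots,Y_n)$ with continuous margins is the function $C:[0,1]^n\to[0,1]$ with $\Pr[Y_1\le y_1,\dots,Y_n\le y_n]=C(\Pr[Y_1\le y_1],\dots,\Pr[Y_n\le y_n])$ for all $y\in\mathbb R^n$. The weak lower tail dependence function of $C$ is $$\chi(\lambda_1,\dots,\lambda_n)=\lim_{u\downarrow0}\frac{\min_i\ln u^{\lambda_i}}{\ln C(u^{\lambda_1},\dots,u^{\lambda_n})}.$$ $\Delta_n=\{w\in\mathbb R^n:\ w_i\ge0,\ i=1,\dots,n,\ \sum_{i=1}^nw_i=1\}$. *)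

theory Defs
  imports "HOL-Probability.Probability"
begin

text \<open>Constants count as (degenerate) Gaussian variables, as is needed for linear combinations
  of the components of a Gaussian vector.\<close>

definition gaussian_var :: "'a measure \<Rightarrow> ('a \<Rightarrow> real) \<Rightarrow> bool" where
  "gaussian_var M X \<longleftrightarrow> X \<in> borel_measurable M \<and>
     ((\<exists>\<mu> \<sigma>. \<sigma> > 0 \<and> distributed M lborel X (normal_density \<mu> \<sigma>)) \<or>
      (\<exists>c. AE x in M. X x = c))"

definition gaussian_vector :: "'a measure \<Rightarrow> ('a \<Rightarrow> real ^ 'n) \<Rightarrow> bool" where
  "gaussian_vector M Y \<longleftrightarrow> Y \<in> borel_measurable M \<and>
     (\<forall>a. gaussian_var M (\<lambda>x. a \<bullet> Y x))"

definition covariance :: "'a measure \<Rightarrow> ('a \<Rightarrow> real) \<Rightarrow> ('a \<Rightarrow> real) \<Rightarrow> real" where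
  "covariance M X Z =
     (LINT x|M. (X x - (LINT y|M. X y)) * (Z x - (LINT y|M. Z y)))"

definition correlation_matrix :: "'a measure \<Rightarrow> ('a \<Rightarrow> real ^ 'n) \<Rightarrow> real ^ 'n ^ 'n" where
  "correlation_matrix M Y = (\<chi> i j.
     covariance M (\<lambda>x. Y x $ i) (\<lambda>x. Y x $ j) /
     sqrt (covariance M (\<lambda>x. Y x $ i) (\<lambda>x. Y x $ i) *
           covariance M (\<lambda>x. Y x $ j) (\<lambda>x. Y x $ j)))"

text \<open>Nonconstant in the probabilistic sense: no component is almost surely constant.\<close>

definition nonconstant_components :: "'a measure \<Rightarrow> ('a \<Rightarrow> real ^ 'n) \<Rightarrow> bool" where
  "nonconstant_components M Y \<longleftrightarrow> (\<forall>i. \<not> (\<exists>c. AE x in M. Y x $ i = c))"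

text \<open>A copula is a function from the unit cube to the unit interval; its values outside the cube
  are irrelevant. Continuity of the margins is not repeated here: it holds automatically for
  Gaussian vectors with nonconstant components.\<close>

definition copula_of :: "'a measure \<Rightarrow> ('a \<Rightarrow> real ^ 'n) \<Rightarrow> (real ^ 'n \<Rightarrow> real) \<Rightarrow> bool" where
  "copula_of M Y C \<longleftrightarrow>
     (\<forall>p. (\<forall>i. p $ i \<in> {0..1}) \<longrightarrow> C p \<in> {0..1}) \<and>
     (\<forall>y. measure M {x \<in> space M. \<forall>i. Y x $ i \<le> y $ i} =
        C (\<chi> i. measure M {x \<in> space M. Y x $ i \<le> y $ i}))"

definition tail_quotient :: "(real ^ 'n \<Rightarrow> real) \<Rightarrow> real ^ 'n \<Rightarrow> real \<Rightarrow> real" where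
  "tail_quotient C lam u = (MIN i. ln (u powr (lam $ i))) / ln (C (\<chi> i. u powr (lam $ i)))"

definition weak_lower_tail_dependence :: "(real ^ 'n \<Rightarrow> real) \<Rightarrow> real ^ 'n \<Rightarrow> real" where
  "weak_lower_tail_dependence C lam = Lim (at_right 0) (tail_quotient C lam)"

definition prob_simplex :: "(real ^ 'n) set" where
  "prob_simplex = {w. (\<forall>i. 0 \<le> w $ i) \<and> (\<Sum>i\<in>UNIV. w $ i) = 1}"

definition scaled_matrix :: "real ^ 'n ^ 'n \<Rightarrow> real ^ 'n \<Rightarrow> real ^ 'n ^ 'n" where
  "scaled_matrix R lam = (\<chi> i j. R $ i $ j / sqrt (lam $ i * lam $ j))"

end

theory Submission
  imports Defs "HOL-Real_Asymp.Real_Asymp"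
begin

text \<open>Standardize the Gaussian vector to \<open>X\<close> with covariance \<open>R\<close>, let \<open>w\<close> minimize the quadratic form
  of \<open>\<Sigma>\<close> on the simplex with minimum \<open>m\<close>, and put \<open>a\<^sub>i = w\<^sub>i / sqrt \<lambda>\<^sub>i\<close>, \<open>L = - ln u\<close>. The event defining
  the copula at \<open>u powr \<lambda>\<^sub>i\<close> is \<open>X\<^sub>i \<le> - q\<^sub>i\<close> for all \<open>i\<close>, where \<open>q\<^sub>i\<close> is asymptotic to \<open>sqrt (2 \<lambda>\<^sub>i L)\<close>.
  It forces \<open>a \<bullet> X\<close>, a variable of variance \<open>m\<close>, below about \<open>- sqrt (2 L)\<close>, so Chernoff's bound gives
  probability at most \<open>exp (- L (1 + o(1)) / m)\<close>. Conversely, optimality of \<open>w\<close> means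
  \<open>(R a)\<^sub>i \<ge> m sqrt \<lambda>\<^sub>i\<close>, so that tilting the law by \<open>exp (- t (a \<bullet> X))\<close> with \<open>t\<close> slightly above
  \<open>sqrt (2 L) / m\<close> recentres \<open>X\<close> inside the orthant; undoing the tilt gives the matching lower bound.
  Only the moment generating function of \<open>X\<close> enters, so no multivariate density is needed.\<close>

section \<open>Quadratic forms on the simplex\<close>

lemma symmetric_matrix_inner:
  fixes A :: "real ^ 'n ^ 'n"
  assumes "transpose A = A"
  shows "x \<bullet> (A *v y) = y \<bullet> (A *v x)"
  using dot_lmul_matrix[of x A y] transpose_matrix_vector[of A x] assms by (simp add: inner_commute)

lemma quadratic_form_expand:
  fixes A :: "real ^ 'n ^ 'n"
  assumes "transpose A = A"
  shows "(s *\<^sub>R x + y) \<bullet> (A *v (s *\<^sub>R x + y)) =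
    s\<^sup>2 * (x \<bullet> (A *v x)) + 2 * s * (y \<bullet> (A *v x)) + y \<bullet> (A *v y)"
proof -
  have "A *v (s *\<^sub>R x + y) = s *\<^sub>R (A *v x) + A *v y"
    by (simp add: matrix_vector_right_distrib matrix_vector_mult_scaleR)
  moreover have "x \<bullet> (A *v y) = y \<bullet> (A *v x)"
    using assms by (rule symmetric_matrix_inner)
  ultimately show ?thesis
    by (simp add: inner_add_left inner_add_right power2_eq_square algebra_simps)
qed

text \<open>Along the line \<open>s *\<^sub>R x + A *v x\<close> the form is affine in
  \<open>s\<close>, because its quadratic term vanishes. Being nonnegative, it has slope zero, and
  the slope is twice the squared norm of \<open>A *v x\<close>. Applied to \<open>R\<close>, this
  turns semidefiniteness and a nonzero determinant into positive definiteness.\<close>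

lemma semidefinite_null_vector:
  fixes A :: "real ^ 'n ^ 'n"
  assumes sym: "transpose A = A" and psd: "\<And>y. 0 \<le> y \<bullet> (A *v y)" and null: "x \<bullet> (A *v x) = 0"
  shows "A *v x = 0"
proof -
  define y where "y = A *v x"
  define q where "q = y \<bullet> (A *v y)"
  have ge: "0 \<le> 2 * s * (y \<bullet> y) + q" for s
    using psd[of "s *\<^sub>R x + y"] unfolding quadratic_form_expand[OF sym] null q_def
    by (simp add: y_def)
  have "y \<bullet> y = 0"
  proof (rule ccontr)
    assume "y \<bullet> y \<noteq> 0"
    \<comment> \<open>At the chosen \<open>s\<close> the affine function takes the value -1.\<close>
    then show False
      using ge[of "- (q + 1) / (2 * (y \<bullet> y))"] by (simp add: field_simps)
  qed
  then show ?thesis by (simp add: y_def)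
qed

lemma compact_prob_simplex: "compact (prob_simplex :: (real ^ 'n) set)"
proof -
  have "closed (prob_simplex :: (real ^ 'n) set)"
  proof -
    have "prob_simplex = (\<Inter>i. {w :: real ^ 'n. 0 \<le> w $ i}) \<inter> {w. (\<Sum>i\<in>UNIV. w $ i) = 1}"
      by (auto simp: prob_simplex_def)
    moreover have "closed \<dots>"
      by (intro closed_Int closed_INT ballI closed_Collect_le closed_Collect_eq continuous_intros)
    ultimately show ?thesis by simp
  qed
  moreover have "bounded (prob_simplex :: (real ^ 'n) set)"
  proof (rule boundedI)
    fix w :: "real ^ 'n" assume "w \<in> prob_simplex"
    then have "(\<Sum>i\<in>UNIV. \<bar>w $ i\<bar>) = 1"
      by (simp add: prob_simplex_def)
    then show "norm w \<le> 1"
      using norm_le_l1_cart[of w] by simp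
  qed
  ultimately show ?thesis by (simp add: compact_eq_bounded_closed)
qed

lemma axis_in_prob_simplex: "axis i 1 \<in> prob_simplex"
  by (auto simp: prob_simplex_def axis_def)

lemma ex_arg_min_prob_simplex:
  fixes A :: "real ^ 'n ^ 'n"
  shows "\<exists>w. is_arg_min (\<lambda>v. v \<bullet> (A *v v)) (\<lambda>v. v \<in> prob_simplex) w"
proof -
  have "continuous_on prob_simplex (\<lambda>v. v \<bullet> (A *v v))"
    by (intro continuous_intros linear_continuous_on) (auto simp: linear_linear)
  then obtain w where "w \<in> prob_simplex" "\<forall>v\<in>prob_simplex. w \<bullet> (A *v w) \<le> v \<bullet> (A *v v)"
    using continuous_attains_inf[OF compact_prob_simplex] axis_in_prob_simplex by blast
  then show ?thesis by (auto simp: is_arg_min_linorder)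
qed

text \<open>The variation is from the minimizer towards the \<open>i\<close>-th vertex.\<close>

lemma arg_min_prob_simplex_kkt:
  fixes A :: "real ^ 'n ^ 'n"
  assumes sym: "transpose A = A"
    and min: "is_arg_min (\<lambda>v. v \<bullet> (A *v v)) (\<lambda>v. v \<in> prob_simplex) w"
  shows "w \<bullet> (A *v w) \<le> (A *v w) $ i"
proof (rule ccontr)
  assume neg: "\<not> ?thesis"
  define m where "m = w \<bullet> (A *v w)"
  define d where "d = m - (A *v w) $ i"
  define e where "e = axis i 1 - w"
  define q where "q = e \<bullet> (A *v e)"
  have d: "d > 0" using neg by (simp add: d_def m_def)
  have ew: "e \<bullet> (A *v w) = - d"
    by (simp add: e_def d_def m_def inner_diff_left inner_axis')
  \<comment> \<open>The bound 1 keeps \<open>v\<close> in the simplex. The other bound gives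
    \<open>s * q \<le> d\<close>, so the first-order decrease \<open>2 * s * d\<close> outweighs the
    second-order term \<open>s\<^sup>2 * q\<close>.\<close>
  define s where "s = min 1 (d / (\<bar>q\<bar> + 1))"
  have s: "0 < s" "s \<le> 1" using d by (auto simp: s_def)
  have "s * q \<le> s * \<bar>q\<bar>" using s by (simp add: mult_left_mono)
  also have "\<dots> \<le> d / (\<bar>q\<bar> + 1) * \<bar>q\<bar>"
    by (intro mult_right_mono) (auto simp: s_def)
  also have "\<dots> \<le> d" using d by (simp add: divide_simps algebra_simps)
  finally have sq: "s * q \<le> d" .
  define v where "v = s *\<^sub>R e + w"
  have "v = s *\<^sub>R axis i 1 + (1 - s) *\<^sub>R w"
    by (simp add: v_def e_def algebra_simps)
  then have "v \<in> prob_simplex"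
    using min axis_in_prob_simplex[of i] s
    by (simp add: is_arg_min_linorder prob_simplex_def sum.distrib sum_distrib_left[symmetric])
  then have "m \<le> v \<bullet> (A *v v)"
    using min by (simp add: is_arg_min_linorder m_def)
  also have "\<dots> = s\<^sup>2 * q + 2 * s * (w \<bullet> (A *v e)) + m"
    unfolding v_def quadratic_form_expand[OF sym] by (simp add: q_def m_def)
  also have "w \<bullet> (A *v e) = - d"
    using symmetric_matrix_inner[OF sym] ew by metis
  finally have "0 \<le> s * (s * q - 2 * d)"
    by (simp add: power2_eq_square algebra_simps)
  then have "2 * d \<le> s * q" using s by (simp add: zero_le_mult_iff)
  then show False using sq d by simp
qed

section \<open>Moments of Gaussian variables\<close>

text \<open>Completing the square: an exponential tilt of a normal density shifts its mean, so the
  exponential moment reduces to the total mass of the shifted density.\<close>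

lemma exp_mult_normal_density:
  assumes "\<sigma> > 0"
  shows "normal_density \<mu> \<sigma> x * exp x = exp (\<mu> + \<sigma>\<^sup>2 / 2) * normal_density (\<mu> + \<sigma>\<^sup>2) \<sigma> x"
proof -
  have "- (x - \<mu>)\<^sup>2 / (2 * \<sigma>\<^sup>2) + x = \<mu> + \<sigma>\<^sup>2 / 2 + - (x - (\<mu> + \<sigma>\<^sup>2))\<^sup>2 / (2 * \<sigma>\<^sup>2)"
    using assms by (simp add: field_simps power2_eq_square)
  then show ?thesis
    by (simp add: normal_density_def mult_exp_exp)
qed

lemma (in prob_space) covariance_self: "covariance M X X = expectation (\<lambda>x. (X x - expectation X)\<^sup>2)"
  by (simp add: covariance_def power2_eq_square)

text \<open>The exponential moment at 1 is enough, since any scale can be absorbed in the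
  coefficients of a linear combination. The degenerate case does occur, for instance when all
  coefficients are zero.\<close>

lemma (in prob_space) gaussian_var_moments:
  assumes "gaussian_var M X"
  shows "integrable M X" "integrable M (\<lambda>x. (X x)\<^sup>2)" "integrable M (\<lambda>x. exp (X x))"
    and "expectation (\<lambda>x. exp (X x)) = exp (expectation X + covariance M X X / 2)"
proof -
  have [measurable]: "X \<in> borel_measurable M" using assms by (simp add: gaussian_var_def)
  have "integrable M X \<and> integrable M (\<lambda>x. (X x)\<^sup>2) \<and> integrable M (\<lambda>x. exp (X x)) \<and>
    expectation (\<lambda>x. exp (X x)) = exp (expectation X + covariance M X X / 2)"
  proof -
    consider (normal) \<mu> \<sigma> where "\<sigma> > 0" "distributed M lborel X (normal_density \<mu> \<sigma>)"
      | (const) c where "AE x in M. X x = c"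
      using assms by (auto simp: gaussian_var_def)
    then show ?thesis
    proof cases
      case normal
      have int: "integrable M (\<lambda>x. g (X x)) \<longleftrightarrow> integrable lborel (\<lambda>x. normal_density \<mu> \<sigma> x * g x)"
        if "g \<in> borel_measurable borel" for g :: "real \<Rightarrow> real"
        using distributed_integrable[OF normal(2), of g] that by simp
      have 1: "integrable M X"
        using int[of "\<lambda>x. x"] integrable_normal_moment_nz_1[OF normal(1)] by simp
      have "integrable M (\<lambda>x. (X x - \<mu>)\<^sup>2)"
        using int[of "\<lambda>x. (x - \<mu>)\<^sup>2"] integrable_normal_moment[OF normal(1), of \<mu> 2] by simp
      then have "integrable M (\<lambda>x. (X x - \<mu>)\<^sup>2 + 2 * \<mu> * X x - \<mu>\<^sup>2)"
        using 1 by simp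
      then have 2: "integrable M (\<lambda>x. (X x)\<^sup>2)"
        by (simp add: power2_eq_square algebra_simps)
      have 3: "integrable M (\<lambda>x. exp (X x))"
        using int[of exp] normal(1) by (simp add: exp_mult_normal_density)
      have "expectation (\<lambda>x. exp (X x)) = (\<integral>x. normal_density \<mu> \<sigma> x * exp x \<partial>lborel)"
        using distributed_integral[OF normal(2), of exp] by simp
      also have "\<dots> = exp (\<mu> + \<sigma>\<^sup>2 / 2)"
        using normal(1) by (simp add: exp_mult_normal_density)
      also have "\<mu> = expectation X"
        using normal_distributed_expectation[OF normal] by simp
      also have "\<sigma>\<^sup>2 = covariance M X X"
        using normal_distributed_variance[OF normal] by (simp add: covariance_self)
      finally show ?thesis using 1 2 3 by simp
    next
      case const
      have c: "integrable M (\<lambda>x. g (X x)) \<and> expectation (\<lambda>x. g (X x)) = g c"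
        if [measurable]: "g \<in> borel_measurable borel" for g :: "real \<Rightarrow> real"
      proof -
        have ae: "AE x in M. g (X x) = g c" using const by auto
        show ?thesis
          using integrable_cong_AE[of "\<lambda>x. g (X x)" M "\<lambda>x. g c"]
            integral_cong_AE[of "\<lambda>x. g (X x)" M "\<lambda>x. g c"] ae
          by (simp add: prob_space)
      qed
      have "expectation X = c" using c[of "\<lambda>x. x"] by simp
      moreover have "covariance M X X = 0"
        using c[of "\<lambda>x. (x - c)\<^sup>2"] calculation by (simp add: covariance_self)
      ultimately show ?thesis using c[of "\<lambda>x. x"] c[of "\<lambda>x. x\<^sup>2"] c[of exp] by simp
    qed
  qed
  then show "integrable M X" "integrable M (\<lambda>x. (X x)\<^sup>2)" "integrable M (\<lambda>x. exp (X x))"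
    "expectation (\<lambda>x. exp (X x)) = exp (expectation X + covariance M X X / 2)" by blast+
qed

text \<open>A density rules out atoms, so the distribution function is continuous and takes every
  value strictly between its limits 0 and 1. This realizes prescribed marginal probabilities, hence
  prescribed arguments of the copula.\<close>

lemma (in prob_space) ex_quantile:
  assumes X: "distributed M lborel X (f :: real \<Rightarrow> ennreal)" and p: "0 < p" "p < 1"
  shows "\<exists>y. prob {x \<in> space M. X x \<le> y} = p"
proof -
  have [measurable]: "X \<in> borel_measurable M"
    using distributed_measurable[OF X] by simp
  let ?D = "distr M borel X"
  interpret D: real_distribution ?D by simp
  have "measure ?D {c} = 0" for c
  proof -
    have "?D = distr M lborel X" by (rule distr_cong) auto
    also have "\<dots> = density lborel f" using X by (rule distributed_distr_eq_density)
    finally have "?D = density lborel f" .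
    moreover have "emeasure (density lborel f) {c} = 0"
      using distributed_borel_measurable[OF X] by (subst emeasure_density) auto
    ultimately show ?thesis by (simp add: measure_def)
  qed
  then have cont: "isCont (cdf ?D) c" for c
    by (simp add: D.isCont_cdf)
  obtain a where a: "cdf ?D a < p"
    using order_tendstoD(2)[OF D.cdf_lim_at_bot p(1)] by (auto simp: eventually_at_bot_linorder)
  obtain b where b: "cdf ?D b > p"
    using order_tendstoD(1)[OF D.cdf_lim_at_top_prob p(2)] by (auto simp: eventually_at_top_linorder)
  have "a \<le> b" using a b D.cdf_nondecreasing[of b a] by linarith
  then obtain y where "cdf ?D y = p"
    using IVT[of "cdf ?D" a p b] a b cont by auto
  moreover have "cdf ?D y = prob {x \<in> space M. X x \<le> y}"
    unfolding cdf_def by (subst measure_distr) (auto intro!: arg_cong[where f = prob])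
  ultimately show ?thesis by auto
qed

section \<open>Orthant probabilities\<close>

text \<open>The last assumption is the moment generating function of a centred Gaussian vector with
  covariance \<open>R\<close>. Chernoff bounds and tilted expectations are evaluations of this one
  formula at suitable vectors.\<close>

locale standard_gaussian = prob_space M
  for M :: "'a measure" +
  fixes X :: "'a \<Rightarrow> real ^ 'n" and R :: "real ^ 'n ^ 'n"
  assumes X_measurable [measurable]: "X \<in> borel_measurable M"
    and transpose_R: "transpose R = R"
    and R_diag: "R $ i $ i = 1"
    and integrable_exp: "integrable M (\<lambda>x. exp (a \<bullet> X x))"
    and expectation_exp: "expectation (\<lambda>x. exp (a \<bullet> X x)) = exp (a \<bullet> (R *v a) / 2)"
begin

lemma R_axis_axis: "(R *v axis i 1) $ i = 1"
  by (simp add: matrix_vector_mult_basis column_def R_diag)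

lemma component_measurable [measurable]: "(\<lambda>x. X x $ i) \<in> borel_measurable M"
proof -
  have "(\<lambda>x. axis i 1 \<bullet> X x) \<in> borel_measurable M" by measurable
  then show ?thesis by (simp add: inner_axis')
qed

lemma tail_upper_bound:
  assumes m: "0 < a \<bullet> (R *v a)" and r: "0 \<le> r"
  shows "prob {x \<in> space M. a \<bullet> X x \<le> - r} \<le> exp (- (r\<^sup>2 / (2 * (a \<bullet> (R *v a)))))"
proof -
  define m where "m = a \<bullet> (R *v a)"
  define A where "A = {x \<in> space M. a \<bullet> X x \<le> - r}"
  have [measurable]: "A \<in> sets M" unfolding A_def by measurable
  \<comment> \<open>Chernoff's exponent for \<open>exp (- s * (a \<bullet> X x))\<close> is
    \<open>s\<^sup>2 * m / 2 - s * r\<close>, which is least at \<open>s = r / m\<close>.\<close>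
  define b where "b = (- (r / m)) *\<^sub>R a"
  have b: "b \<bullet> (R *v b) = r\<^sup>2 / m"
    using quadratic_form_expand[OF transpose_R, of "- (r / m)" a 0] assms
    by (simp add: b_def m_def power2_eq_square)
  have "prob A = expectation (indicator A)" by simp
  also have "\<dots> \<le> expectation (\<lambda>x. exp (- (r\<^sup>2 / m)) * exp (b \<bullet> X x))"
  proof (rule integral_mono)
    fix x assume "x \<in> space M"
    show "indicator A x \<le> exp (- (r\<^sup>2 / m)) * exp (b \<bullet> X x)"
    proof (cases "x \<in> A")
      case True
      then have "r / m * r \<le> r / m * (- (a \<bullet> X x))"
        using m r by (intro mult_left_mono) (auto simp: A_def m_def)
      then have "0 \<le> - (r\<^sup>2 / m) + b \<bullet> X x"
        by (simp add: b_def power2_eq_square)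
      then show ?thesis using True by (simp add: mult_exp_exp)
    qed simp
  qed (auto intro: integrable_exp simp: less_top[symmetric])
  also have "\<dots> = exp (- (r\<^sup>2 / m)) * exp (r\<^sup>2 / m / 2)"
    by (simp add: expectation_exp b)
  also have "\<dots> = exp (- (r\<^sup>2 / (2 * m)))"
    by (simp add: mult_exp_exp)
  finally show ?thesis by (simp add: A_def m_def)
qed

text \<open>Exponential tilting by \<open>- t *\<^sub>R a\<close> recentres \<open>X\<close> at \<open>- t *\<^sub>R (R *v a)\<close>, which lies in the
  orthant at depth at least \<open>K\<close>. The two subtracted terms in the bracket of \<open>g\<close> bound the tilted
  mass outside the orthant and the part where \<open>a \<bullet> X\<close> is far below its tilted mean.\<close>

lemma orthant_lower_bound:
  assumes t: "0 \<le> t"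
    and depth: "\<And>i. i \<in> J \<Longrightarrow> K \<le> t * (R *v a) $ i - y i"
    and K: "card J * exp (1 / 2 - K) + exp (a \<bullet> (R *v a) / 2 - K) \<le> 1 / 2"
  shows "exp (- (t\<^sup>2 * (a \<bullet> (R *v a)) / 2 + t * K)) / 2
    \<le> prob {x \<in> space M. \<forall>i\<in>J. X x $ i \<le> - y i}"
proof -
  define m where "m = a \<bullet> (R *v a)"
  define A where "A = {x \<in> space M. \<forall>i\<in>J. X x $ i \<le> - y i}"
  have "finite J" by simp
  then have [measurable]: "A \<in> sets M" unfolding A_def by measurable
  define b where "b = (- t) *\<^sub>R a"
  \<comment> \<open>One more unit of tilt multiplies \<open>exp (b \<bullet> X x)\<close> by
    \<open>exp (- (a \<bullet> X x))\<close>, which exceeds \<open>exp (t * m + K)\<close> where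
    \<open>a \<bullet> X x\<close> is too far down.\<close>
  define b' where "b' = (- (t + 1)) *\<^sub>R a"
  \<comment> \<open>This multiplies \<open>exp (b \<bullet> X x)\<close> by
    \<open>exp (X x $ i)\<close>, which exceeds \<open>exp (- y i)\<close> where constraint
    \<open>i\<close> fails.\<close>
  define c where "c i = b + axis i 1" for i
  have b: "b \<bullet> (R *v b) = t\<^sup>2 * m"
    using quadratic_form_expand[OF transpose_R, of "- t" a 0] by (simp add: b_def m_def)
  have b': "b' \<bullet> (R *v b') = (t + 1)\<^sup>2 * m"
    using quadratic_form_expand[OF transpose_R, of "- (t + 1)" a 0]
    by (simp add: b'_def m_def power2_eq_square algebra_simps)
  have c: "c i \<bullet> (R *v c i) = t\<^sup>2 * m - 2 * t * (R *v a) $ i + 1" for i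
    using quadratic_form_expand[OF transpose_R, of "- t" a "axis i 1"]
    by (simp add: c_def b_def m_def R_axis_axis inner_axis')
  \<comment> \<open>The prefactor is the reciprocal of an upper bound for
    \<open>exp (b \<bullet> X x)\<close> on \<open>a \<bullet> X x \<ge> - t * m - K\<close>;
    together with the subtracted terms this makes \<open>g\<close> a minorant of the indicator of
    the orthant event. As a combination of exponentials, \<open>g\<close> has an explicit
    expectation.\<close>
  define g where "g x = exp (- (t\<^sup>2 * m + t * K)) * (exp (b \<bullet> X x)
    - (\<Sum>i\<in>J. exp (y i) * exp (c i \<bullet> X x)) - exp (- (t * m + K)) * exp (b' \<bullet> X x))" for x
  define B where "B = exp (t\<^sup>2 * m / 2)
    - (\<Sum>i\<in>J. exp (y i) * exp ((t\<^sup>2 * m - 2 * t * (R *v a) $ i + 1) / 2))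
    - exp (- (t * m + K)) * exp ((t + 1)\<^sup>2 * m / 2)"
  have "exp (- (t * m + K)) * exp ((t + 1)\<^sup>2 * m / 2) = exp (t\<^sup>2 * m / 2) * exp (m / 2 - K)"
    by (simp add: mult_exp_exp power2_eq_square field_simps)
  \<comment> \<open>Relative to the total tilted mass \<open>exp (t\<^sup>2 * m / 2)\<close>, each
    constraint costs at most \<open>exp (1 / 2 - K)\<close>, by its depth.\<close>
  moreover have "(\<Sum>i\<in>J. exp (y i) * exp ((t\<^sup>2 * m - 2 * t * (R *v a) $ i + 1) / 2))
      \<le> exp (t\<^sup>2 * m / 2) * (card J * exp (1 / 2 - K))"
  proof -
    have "(\<Sum>i\<in>J. exp (y i) * exp ((t\<^sup>2 * m - 2 * t * (R *v a) $ i + 1) / 2))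
      \<le> (\<Sum>i\<in>J. exp (t\<^sup>2 * m / 2) * exp (1 / 2 - K))"
    proof (rule sum_mono)
      fix i assume "i \<in> J"
      then show "exp (y i) * exp ((t\<^sup>2 * m - 2 * t * (R *v a) $ i + 1) / 2)
          \<le> exp (t\<^sup>2 * m / 2) * exp (1 / 2 - K)"
        using depth[of i] by (simp add: mult_exp_exp field_simps)
    qed
    then show ?thesis by (simp add: mult.left_commute)
  qed
  moreover have "exp (t\<^sup>2 * m / 2) * (card J * exp (1 / 2 - K) + exp (m / 2 - K))
      \<le> exp (t\<^sup>2 * m / 2) * (1 / 2)"
    using K by (intro mult_left_mono) (auto simp: m_def)
  ultimately have "exp (t\<^sup>2 * m / 2) / 2 \<le> B"
    unfolding B_def distrib_left by linarith
  then have "exp (- (t\<^sup>2 * m + t * K)) * (exp (t\<^sup>2 * m / 2) / 2) \<le> exp (- (t\<^sup>2 * m + t * K)) * B"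
    by (intro mult_left_mono) auto
  also have "\<dots> = expectation g"
    unfolding g_def B_def by (simp add: integrable_exp expectation_exp b b' c)
  finally have "exp (- (t\<^sup>2 * m + t * K)) * (exp (t\<^sup>2 * m / 2) / 2) \<le> expectation g" .
  moreover have "exp (- (t\<^sup>2 * m + t * K)) * (exp (t\<^sup>2 * m / 2) / 2)
      = exp (- (t\<^sup>2 * m / 2 + t * K)) / 2"
    by (simp add: mult_exp_exp)
  moreover have "expectation g \<le> expectation (indicator A)"
  proof (rule integral_mono)
    show "integrable M g" unfolding g_def
      by (simp add: integrable_exp)
    fix x assume x: "x \<in> space M"
    have nonneg: "0 \<le> (\<Sum>i\<in>J. exp (y i) * exp (c i \<bullet> X x))"
      "0 \<le> exp (- (t * m + K)) * exp (b' \<bullet> X x)"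
      by (auto intro: sum_nonneg)
    show "g x \<le> indicator A x"
    proof (cases "x \<in> A")
      case False
      then obtain i where i: "i \<in> J" "- y i < X x $ i" using x by (auto simp: A_def not_le)
      have "exp (b \<bullet> X x) \<le> exp (y i) * exp (c i \<bullet> X x)"
        using i by (simp add: mult_exp_exp c_def inner_add_left inner_axis')
      also have "\<dots> \<le> (\<Sum>i\<in>J. exp (y i) * exp (c i \<bullet> X x))"
        using i(1) by (intro member_le_sum) auto
      finally have "exp (b \<bullet> X x) - (\<Sum>i\<in>J. exp (y i) * exp (c i \<bullet> X x))
          - exp (- (t * m + K)) * exp (b' \<bullet> X x) \<le> 0"
        using nonneg by linarith
      then have "g x \<le> 0" unfolding g_def by (intro mult_nonneg_nonpos) auto
      then show ?thesis by (simp add: indicator_def)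
    next
      case True
      show ?thesis
      proof (cases "a \<bullet> X x < - t * m - K")
        case True
        have "exp (b \<bullet> X x) \<le> exp (- (t * m + K)) * exp (b' \<bullet> X x)"
          using True by (simp add: mult_exp_exp b_def b'_def algebra_simps)
        then have "exp (b \<bullet> X x) - (\<Sum>i\<in>J. exp (y i) * exp (c i \<bullet> X x))
          - exp (- (t * m + K)) * exp (b' \<bullet> X x) \<le> 0"
          using nonneg by linarith
        then have "g x \<le> 0" unfolding g_def by (intro mult_nonneg_nonpos) auto
        then show ?thesis by (simp add: indicator_def)
      next
        case False
        then have "t * (- (a \<bullet> X x)) \<le> t * (t * m + K)"
          using t by (intro mult_left_mono) auto
        then have "b \<bullet> X x \<le> t\<^sup>2 * m + t * K"
          by (simp add: b_def power2_eq_square algebra_simps)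
        then have "exp (- (t\<^sup>2 * m + t * K)) * exp (b \<bullet> X x) \<le> 1"
          by (simp add: mult_exp_exp)
        moreover have "g x \<le> exp (- (t\<^sup>2 * m + t * K)) * exp (b \<bullet> X x)"
          unfolding g_def using nonneg by (intro mult_left_mono, linarith, simp)
        ultimately show ?thesis using \<open>x \<in> A\<close> by simp
      qed
    qed
  qed (simp add: less_top[symmetric])
  ultimately show ?thesis by (simp add: A_def m_def)
qed

section \<open>Two-sided bounds for the marginal quantiles\<close>

lemma quantile_le:
  assumes "prob {x \<in> space M. X x $ i \<le> - y} = exp (- l)" and "0 \<le> l"
  shows "y \<le> sqrt (2 * l)"
proof (cases "0 \<le> y")
  case True
  then have "exp (- l) \<le> exp (- (y\<^sup>2 / 2))"
    using tail_upper_bound[of "axis i 1" y] assms(1) by (simp add: R_axis_axis inner_axis')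
  then show ?thesis by (intro real_le_rsqrt) simp
next
  case False
  then show ?thesis using real_sqrt_ge_zero[of "2 * l"] assms(2) by linarith
qed

text \<open>This is \<open>orthant_lower_bound\<close> for a single constraint and an axis vector,
  read backwards: a tail probability as small as \<open>exp (- l)\<close> forces a high level. The
  second condition on \<open>K\<close> is the one of that lemma for one constraint and variance
  1.\<close>

lemma quantile_ge:
  assumes p: "prob {x \<in> space M. X x $ i \<le> - y} = exp (- l)"
    and K: "0 \<le> K" "2 * exp (1 / 2 - K) \<le> 1 / 2"
    and l: "K < sqrt (2 * l - 2 * ln 2)"
  shows "sqrt (2 * l - 2 * ln 2) - 2 * K \<le> y"
proof -
  \<comment> \<open>The smallest nonnegative tilt that reaches depth \<open>K\<close>. The value 0
    is excluded at the end by the assumption \<open>l\<close>.\<close>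
  define t where "t = max 0 (y + K)"
  have t: "0 \<le> t" by (simp add: t_def)
  have "exp (- (t\<^sup>2 / 2 + t * K)) / 2 \<le> exp (- l)"
    using orthant_lower_bound[of t "{i}" K "axis i 1" "\<lambda>_. y"] p K
      R_axis_axis[of i] by (simp add: t_def inner_axis')
  then have "ln (exp (- (t\<^sup>2 / 2 + t * K)) / 2) \<le> ln (exp (- l))"
    by (subst ln_le_cancel_iff) auto
  then have "- (t\<^sup>2 / 2 + t * K) - ln 2 \<le> - l"
    by (simp add: ln_div)
  moreover have "(t + K)\<^sup>2 = t\<^sup>2 + 2 * (t * K) + K\<^sup>2" by (simp add: power2_sum)
  moreover have "0 \<le> K\<^sup>2" by simp
  ultimately have "2 * l - 2 * ln 2 \<le> (t + K)\<^sup>2" by linarith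
  then have "sqrt (2 * l - 2 * ln 2) \<le> t + K"
    using t K by (intro real_le_lsqrt) auto
  then show ?thesis using l by (auto simp: t_def max_def split: if_splits)
qed

section \<open>Logarithmic asymptotics of the orthant probability\<close>

lemma scaled_matrix_form:
  assumes lam: "\<And>i. 0 < lam $ i"
  shows "transpose (scaled_matrix R lam) = scaled_matrix R lam"
    and "(R *v (\<chi> i. w $ i / sqrt (lam $ i))) $ i = sqrt (lam $ i) * (scaled_matrix R lam *v w) $ i"
    and "(\<chi> i. w $ i / sqrt (lam $ i)) \<bullet> (R *v (\<chi> i. w $ i / sqrt (lam $ i)))
      = w \<bullet> (scaled_matrix R lam *v w)"
proof -
  have "R $ i $ j = R $ j $ i" for i j
    using transpose_R by (metis transpose_def vec_lambda_beta)
  then show "transpose (scaled_matrix R lam) = scaled_matrix R lam"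
    by (simp add: transpose_def scaled_matrix_def vec_eq_iff mult.commute)
  show *: "(R *v (\<chi> i. w $ i / sqrt (lam $ i))) $ i
      = sqrt (lam $ i) * (scaled_matrix R lam *v w) $ i" for i
    using lam[of i]
    by (simp add: matrix_vector_mult_def scaled_matrix_def sum_distrib_left real_sqrt_mult)
  show "(\<chi> i. w $ i / sqrt (lam $ i)) \<bullet> (R *v (\<chi> i. w $ i / sqrt (lam $ i)))
      = w \<bullet> (scaled_matrix R lam *v w)"
    unfolding inner_vec_def * using lam by (intro sum.cong) (auto simp: less_imp_neq[symmetric])
qed

text \<open>The quantiles are known up to bounded errors. These change the exponents, which are of
  order \<open>L\<close>, only by terms of order \<open>sqrt L\<close>, so the upper and the lower
  bound for \<open>- ln P / L\<close> have the same limit.\<close>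

lemma orthant_log_asymptotics:
  fixes q :: "real \<Rightarrow> real ^ 'n"
  assumes lam: "\<And>i. 0 < lam $ i"
    and pd: "\<And>a. a \<noteq> 0 \<Longrightarrow> 0 < a \<bullet> (R *v a)"
    and w: "is_arg_min (\<lambda>v. v \<bullet> (scaled_matrix R lam *v v)) (\<lambda>v. v \<in> prob_simplex) w"
    and q: "\<And>L i. 0 < L \<Longrightarrow> prob {x \<in> space M. X x $ i \<le> - q L $ i} = exp (- (lam $ i * L))"
  shows "0 < w \<bullet> (scaled_matrix R lam *v w)" (is "0 < ?m")
    and "((\<lambda>L. - ln (prob {x \<in> space M. \<forall>i. X x $ i \<le> - q L $ i}) / L)
      \<longlongrightarrow> 1 / (w \<bullet> (scaled_matrix R lam *v w))) at_top"
proof -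
  define m where "m = w \<bullet> (scaled_matrix R lam *v w)"
  define a where "a = (\<chi> i. w $ i / sqrt (lam $ i))"
  define P where "P L = prob {x \<in> space M. \<forall>i. X x $ i \<le> - q L $ i}" for L
  have w_simplex: "0 \<le> w $ i" "(\<Sum>i\<in>UNIV. w $ i) = 1" for i
    using w by (auto simp: is_arg_min_linorder prob_simplex_def)
  have a_nonneg: "0 \<le> a $ i" for i
    using w_simplex(1)[of i] lam[of i] by (simp add: a_def)
  have am: "a \<bullet> (R *v a) = m"
    unfolding a_def m_def using lam by (rule scaled_matrix_form(3))
  have "a \<noteq> 0"
  proof
    assume "a = 0"
    then have "w $ i = 0" for i
      using lam[of i] by (simp add: a_def vec_eq_iff) (metis less_irrefl)
    then show False using w_simplex(2) by simp
  qed
  then have m: "0 < m" using pd am by metis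
  then show "0 < ?m" by (simp add: m_def)
  \<comment> \<open>By optimality, tilting along \<open>a\<close> moves every coordinate at the
    required rate, including those with \<open>w $ i = 0\<close>.\<close>
  have Ra: "sqrt (lam $ i) * m \<le> (R *v a) $ i" for i
  proof -
    have "m \<le> (scaled_matrix R lam *v w) $ i"
      unfolding m_def by (rule arg_min_prob_simplex_kkt[OF scaled_matrix_form(1)[OF lam] w])
    then show ?thesis
      using lam[of i] unfolding a_def scaled_matrix_form(2)[OF lam] by simp
  qed

  \<comment> \<open>One constant for two uses: \<open>K1\<close> serves \<open>quantile_ge\<close>,
    and \<open>K2\<close> serves \<open>orthant_lower_bound\<close> with all coordinates
    constrained. The coefficient \<open>CARD('n) + 2\<close> covers both.\<close>
  obtain K where K0: "0 \<le> K" and K1: "2 * exp (1 / 2 - K) \<le> 1 / 2"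
    and K2: "CARD('n) * exp (1 / 2 - K) + exp (m / 2 - K) \<le> 1 / 2"
  proof -
    have "((\<lambda>K. (real CARD('n) + 2) * exp (1 / 2 - K) + exp (m / 2 - K)) \<longlongrightarrow> 0) at_top"
      by real_asymp
    then have "\<forall>\<^sub>F K in at_top. (real CARD('n) + 2) * exp (1 / 2 - K) + exp (m / 2 - K) < 1 / 2"
      by (rule order_tendstoD) simp
    then have "\<forall>\<^sub>F K in at_top. 0 \<le> K \<and>
        (real CARD('n) + 2) * exp (1 / 2 - K) + exp (m / 2 - K) < 1 / 2"
      using eventually_ge_at_top[of 0] by eventually_elim simp
    then obtain K where "0 \<le> K"
        "(real CARD('n) + 2) * exp (1 / 2 - K) + exp (m / 2 - K) < 1 / 2"
      using eventually_happens'[OF trivial_limit_at_top_linorder] by blast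
    moreover have "0 \<le> real CARD('n) * exp (1 / 2 - K)" "0 < exp (1 / 2 - K)" "0 < exp (m / 2 - K)"
      by auto
    ultimately show thesis
      using that[of K] unfolding distrib_right by linarith
  qed

  \<comment> \<open>The tilt \<open>sqrt (2 * L) / m\<close> only offsets the quantiles. The extra
    amount \<open>K / (sqrt (lam $ i) * m)\<close> gives coordinate \<open>i\<close> depth
    \<open>K\<close>, and the sum serves all coordinates at once.\<close>
  define K' where "K' = (\<Sum>i\<in>UNIV. K / (sqrt (lam $ i) * m))"
  define t where "t L = sqrt (2 * L) / m + K'" for L
  \<comment> \<open>A lower bound for \<open>a \<bullet> q L\<close> obtained from
    \<open>quantile_ge\<close>. Its leading term is \<open>sqrt (2 * L)\<close>, since
    \<open>a $ i * sqrt (lam $ i) = w $ i\<close> and these weights sum to 1.\<close>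
  define r where "r L = (\<Sum>i\<in>UNIV. a $ i * (sqrt (2 * (lam $ i * L) - 2 * ln 2) - 2 * K))" for L
  have K'_nonneg: "0 \<le> K'"
    unfolding K'_def using K0 m lam by (intro sum_nonneg) (simp add: less_imp_le)

  have P_lower: "exp (- ((t L)\<^sup>2 * m / 2 + t L * K)) / 2 \<le> P L" if L: "0 < L" for L
  proof -
    have "K \<le> t L * (R *v a) $ i - q L $ i" for i
    proof -
      have s: "0 < sqrt (lam $ i) * m" using lam m by simp
      have "K / (sqrt (lam $ i) * m) \<le> K'"
        unfolding K'_def using K0 m lam by (intro member_le_sum) (auto simp: less_imp_le)
      then have "K \<le> K' * (sqrt (lam $ i) * m)"
        using s by (simp add: pos_divide_le_eq)
      moreover have "q L $ i \<le> sqrt (2 * (lam $ i * L))"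
        using lam[of i] L q by (intro quantile_le) auto
      moreover have "t L * (sqrt (lam $ i) * m)
          = sqrt (2 * (lam $ i * L)) + K' * (sqrt (lam $ i) * m)"
        using m by (simp add: t_def real_sqrt_mult field_simps)
      moreover have "t L * (sqrt (lam $ i) * m) \<le> t L * (R *v a) $ i"
        using K'_nonneg L m Ra by (intro mult_left_mono) (auto simp: t_def)
      ultimately show ?thesis by linarith
    qed
    then show ?thesis
      using orthant_lower_bound[of "t L" UNIV K a "\<lambda>i. q L $ i"] K2 K'_nonneg L m
      by (simp add: am P_def t_def)
  qed

  have r_limit: "((\<lambda>L. r L / sqrt L) \<longlongrightarrow> sqrt 2) at_top"
  proof -
    have "((\<lambda>L. (sqrt (2 * (l * L) - 2 * ln 2) - 2 * K) / sqrt L) \<longlongrightarrow> sqrt (2 * l)) at_top"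
      if "0 < l" for l
      using that by (subst powr_half_sqrt[symmetric]) (simp, real_asymp)
    then have "((\<lambda>L. \<Sum>i\<in>UNIV. a $ i * ((sqrt (2 * (lam $ i * L) - 2 * ln 2) - 2 * K) / sqrt L))
        \<longlongrightarrow> (\<Sum>i\<in>UNIV. a $ i * sqrt (2 * lam $ i))) at_top"
      using lam by (intro tendsto_sum tendsto_mult_left) auto
    moreover have "(\<Sum>i\<in>UNIV. a $ i * sqrt (2 * lam $ i)) = sqrt 2 * (\<Sum>i\<in>UNIV. w $ i)"
      unfolding sum_distrib_left using lam
      by (intro sum.cong) (auto simp: a_def real_sqrt_mult less_imp_neq[symmetric])
    ultimately show ?thesis
      by (simp add: r_def sum_divide_distrib w_simplex)
  qed

  have P_upper: "\<forall>\<^sub>F L in at_top. P L \<le> exp (- ((r L)\<^sup>2 / (2 * m)))"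
  proof -
    have "\<forall>\<^sub>F L in at_top. K < sqrt (2 * (lam $ i * L) - 2 * ln 2)" for i
      using lam[of i] by real_asymp
    then have "\<forall>\<^sub>F L in at_top. \<forall>i. K < sqrt (2 * (lam $ i * L) - 2 * ln 2)"
      by (rule eventually_all_finite)
    moreover have "\<forall>\<^sub>F L in at_top. 0 < r L / sqrt L"
      using r_limit by (rule order_tendstoD) simp
    ultimately show ?thesis using eventually_gt_at_top[of 0]
    proof eventually_elim
      case (elim L)
      have r: "0 \<le> r L"
        using elim by (simp add: zero_less_divide_iff)
      have "{x \<in> space M. \<forall>i. X x $ i \<le> - q L $ i} \<subseteq> {x \<in> space M. a \<bullet> X x \<le> - r L}"
      proof clarsimp
        fix x assume x: "\<forall>i. X x $ i \<le> - q L $ i"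
        have "a \<bullet> X x \<le> (\<Sum>i\<in>UNIV. a $ i * - (sqrt (2 * (lam $ i * L) - 2 * ln 2) - 2 * K))"
          unfolding inner_vec_def inner_real_def
        proof (intro sum_mono mult_left_mono a_nonneg)
          fix i
          have "sqrt (2 * (lam $ i * L) - 2 * ln 2) - 2 * K \<le> q L $ i"
            using elim q K0 K1 by (intro quantile_ge) auto
          then show "X x $ i \<le> - (sqrt (2 * (lam $ i * L) - 2 * ln 2) - 2 * K)"
            using x[rule_format, of i] by linarith
        qed
        then show "a \<bullet> X x \<le> - r L"
          by (simp only: r_def mult_minus_right sum_negf)
      qed
      then have "P L \<le> prob {x \<in> space M. a \<bullet> X x \<le> - r L}"
        unfolding P_def by (intro finite_measure_mono) auto
      also have "\<dots> \<le> exp (- ((r L)\<^sup>2 / (2 * m)))"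
        using tail_upper_bound[of a "r L"] r m by (simp add: am)
      finally show ?case .
    qed
  qed

  have "((\<lambda>L. - ln (P L) / L) \<longlongrightarrow> 1 / m) at_top"
  proof (rule tendsto_sandwich)
    have "((\<lambda>L. (r L / sqrt L)\<^sup>2 / (2 * m)) \<longlongrightarrow> (sqrt 2)\<^sup>2 / (2 * m)) at_top"
      using m by (intro tendsto_intros r_limit) auto
    then show "((\<lambda>L. (r L / sqrt L)\<^sup>2 / (2 * m)) \<longlongrightarrow> 1 / m) at_top" by simp
    have "(2 powr (1 / 2) * inverse m)\<^sup>2 * m / 2 = 1 / m"
      using m by (simp add: powr_half_sqrt power_mult_distrib) (simp add: power2_eq_square field_simps)
    moreover have "((\<lambda>L. (ln 2 + (t L)\<^sup>2 * m / 2 + t L * K) / L)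
        \<longlongrightarrow> (2 powr (1 / 2) * inverse m)\<^sup>2 * m / 2) at_top"
      unfolding t_def using m by real_asymp
    ultimately show "((\<lambda>L. (ln 2 + (t L)\<^sup>2 * m / 2 + t L * K) / L) \<longlongrightarrow> 1 / m) at_top"
      by simp
    show "\<forall>\<^sub>F L in at_top. (r L / sqrt L)\<^sup>2 / (2 * m) \<le> - ln (P L) / L"
      using P_upper eventually_gt_at_top[of 0]
    proof eventually_elim
      case (elim L)
      have "0 < P L" using P_lower[of L] elim(2) by (smt (verit) exp_gt_zero half_gt_zero)
      then have "ln (P L) \<le> - ((r L)\<^sup>2 / (2 * m))"
        using ln_mono[OF elim(1)] by simp
      then have "(r L)\<^sup>2 / (2 * m) / L \<le> - ln (P L) / L"
        using elim by (intro divide_right_mono) auto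
      then show ?case using elim by (simp add: power_divide mult.commute)
    qed
    show "\<forall>\<^sub>F L in at_top. - ln (P L) / L \<le> (ln 2 + (t L)\<^sup>2 * m / 2 + t L * K) / L"
      using eventually_gt_at_top[of 0]
    proof eventually_elim
      case (elim L)
      have "ln (exp (- ((t L)\<^sup>2 * m / 2 + t L * K)) / 2) \<le> ln (P L)"
        using P_lower[OF elim] by (intro ln_mono) auto
      then show ?case
        using elim by (intro divide_right_mono) (auto simp: ln_div)
    qed
  qed
  then show "((\<lambda>L. - ln (prob {x \<in> space M. \<forall>i. X x $ i \<le> - q L $ i}) / L) \<longlongrightarrow> 1 / ?m) at_top"
    by (simp add: P_def m_def)
qed

end

section \<open>Standardization of Gaussian vectors\<close>

lemma gaussian_vector_component:
  assumes "gaussian_vector M Y"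
  shows "gaussian_var M (\<lambda>x. Y x $ i)"
proof -
  have "gaussian_var M (\<lambda>x. axis i 1 \<bullet> Y x)"
    using assms unfolding gaussian_vector_def by blast
  then show ?thesis by (simp add: inner_axis')
qed

lemma (in prob_space) nonconstant_gaussian_var:
  assumes "gaussian_var M X" "\<not> (\<exists>c. AE x in M. X x = c)"
  shows "0 < covariance M X X"
    and "0 < p \<Longrightarrow> p < 1 \<Longrightarrow> \<exists>y. prob {x \<in> space M. X x \<le> y} = p"
proof -
  obtain \<mu> \<sigma> where X: "\<sigma> > 0" "distributed M lborel X (normal_density \<mu> \<sigma>)"
    using assms by (auto simp: gaussian_var_def)
  show "0 < covariance M X X"
    using normal_distributed_variance[OF X] X(1) by (simp add: covariance_self)
  show "\<exists>y. prob {x \<in> space M. X x \<le> y} = p" if "0 < p" "p < 1"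
    using X(2) that by (rule ex_quantile)
qed

lemma (in prob_space) gaussian_vector_covariance:
  assumes Y: "gaussian_vector M Y"
  shows "expectation (\<lambda>x. a \<bullet> Y x) = (\<Sum>i\<in>UNIV. a $ i * expectation (\<lambda>x. Y x $ i))"
    and "covariance M (\<lambda>x. a \<bullet> Y x) (\<lambda>x. a \<bullet> Y x)
      = (\<Sum>i\<in>UNIV. \<Sum>j\<in>UNIV. a $ i * a $ j * covariance M (\<lambda>x. Y x $ i) (\<lambda>x. Y x $ j))"
proof -
  define \<mu> where "\<mu> i = expectation (\<lambda>x. Y x $ i)" for i
  have int: "integrable M (\<lambda>x. Y x $ i)" for i
    using gaussian_var_moments(1)[OF gaussian_vector_component[OF Y]] .
  have int_mult: "integrable M (\<lambda>x. Y x $ i * Y x $ j)" for i j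
  proof -
    have sq: "integrable M (\<lambda>x. (Y x $ k)\<^sup>2)" for k
      using gaussian_var_moments(2)[OF gaussian_vector_component[OF Y]] .
    \<comment> \<open>Polarization: the product is obtained from squares of linear combinations,
      which are Gaussian and hence square integrable.\<close>
    have "gaussian_var M (\<lambda>x. (axis i 1 + axis j 1) \<bullet> Y x)"
      using Y unfolding gaussian_vector_def by blast
    then have "integrable M (\<lambda>x. (Y x $ i + Y x $ j)\<^sup>2)"
      using gaussian_var_moments(2) by (simp add: inner_add_left inner_axis')
    then have "integrable M (\<lambda>x. ((Y x $ i + Y x $ j)\<^sup>2 - (Y x $ i)\<^sup>2 - (Y x $ j)\<^sup>2) / 2)"
      using sq by simp
    then show ?thesis by (simp add: power2_sum)
  qed
  have int_cov: "integrable M (\<lambda>x. (Y x $ i - \<mu> i) * (Y x $ j - \<mu> j))" for i j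
    using int int_mult by (simp add: algebra_simps)
  show mean: "expectation (\<lambda>x. a \<bullet> Y x) = (\<Sum>i\<in>UNIV. a $ i * expectation (\<lambda>x. Y x $ i))"
    unfolding inner_vec_def using int by simp
  have "a \<bullet> Y x - expectation (\<lambda>x. a \<bullet> Y x) = (\<Sum>i\<in>UNIV. a $ i * (Y x $ i - \<mu> i))" for x
    unfolding mean \<mu>_def by (simp add: inner_vec_def sum_subtractf right_diff_distrib)
  then have "covariance M (\<lambda>x. a \<bullet> Y x) (\<lambda>x. a \<bullet> Y x)
      = expectation (\<lambda>x. \<Sum>i\<in>UNIV. \<Sum>j\<in>UNIV. a $ i * a $ j * ((Y x $ i - \<mu> i) * (Y x $ j - \<mu> j)))"
    by (simp add: covariance_def sum_product mult_ac)
  also have "\<dots> = (\<Sum>i\<in>UNIV. \<Sum>j\<in>UNIV. a $ i * a $ j *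
      expectation (\<lambda>x. (Y x $ i - \<mu> i) * (Y x $ j - \<mu> j)))"
    using int_cov by simp
  finally show "covariance M (\<lambda>x. a \<bullet> Y x) (\<lambda>x. a \<bullet> Y x)
      = (\<Sum>i\<in>UNIV. \<Sum>j\<in>UNIV. a $ i * a $ j * covariance M (\<lambda>x. Y x $ i) (\<lambda>x. Y x $ j))"
    by (simp add: covariance_def \<mu>_def)
qed

definition standardized :: "'a measure \<Rightarrow> ('a \<Rightarrow> real ^ 'n) \<Rightarrow> 'a \<Rightarrow> real ^ 'n" where
  "standardized M Y x = (\<chi> i. (Y x $ i - (LINT x|M. Y x $ i)) /
     sqrt (covariance M (\<lambda>x. Y x $ i) (\<lambda>x. Y x $ i)))"

text \<open>Up to an additive constant, a linear combination of the standardized components is one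
  of the original components with rescaled coefficients, hence Gaussian. Its variance is
  \<open>a \<bullet> (R *v a)\<close>, which gives both the moment generating function and
  semidefiniteness.\<close>

lemma (in prob_space)
  assumes Y: "gaussian_vector M Y" and nc: "nonconstant_components M Y"
  shows standard_gaussian_standardized:
      "standard_gaussian M (standardized M Y) (correlation_matrix M Y)"
    and correlation_matrix_semidefinite: "0 \<le> a \<bullet> (correlation_matrix M Y *v a)"
proof -
  define \<mu> where "\<mu> = (\<chi> i. expectation (\<lambda>x. Y x $ i))"
  define c where "c i j = covariance M (\<lambda>x. Y x $ i) (\<lambda>x. Y x $ j)" for i j
  define R where "R = correlation_matrix M Y"
  define sc where "sc a = (\<chi> i. a $ i / sqrt (c i i))" for a
  have pos: "0 < c i i" for i
    using nonconstant_gaussian_var(1)[OF gaussian_vector_component[OF Y]] nc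
    by (auto simp: c_def nonconstant_components_def)
  have R: "R $ i $ j = c i j / (sqrt (c i i) * sqrt (c j j))" for i j
    by (simp add: R_def correlation_matrix_def c_def real_sqrt_mult)
  have X: "a \<bullet> standardized M Y x = sc a \<bullet> Y x - sc a \<bullet> \<mu>" for a x
    unfolding inner_diff_right[symmetric]
    by (simp add: inner_vec_def standardized_def sc_def \<mu>_def c_def)
  have cov: "covariance M (\<lambda>x. sc a \<bullet> Y x) (\<lambda>x. sc a \<bullet> Y x) = a \<bullet> (R *v a)" for a
    unfolding gaussian_vector_covariance(2)[OF Y]
    by (simp add: inner_vec_def matrix_vector_mult_def sum_distrib_left R sc_def c_def mult_ac)
  have mean: "expectation (\<lambda>x. sc a \<bullet> Y x) = sc a \<bullet> \<mu>" for a
    unfolding gaussian_vector_covariance(1)[OF Y] by (simp add: inner_vec_def \<mu>_def)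
  have gauss: "gaussian_var M (\<lambda>x. sc a \<bullet> Y x)" for a
    using Y unfolding gaussian_vector_def by blast
  have "0 \<le> a \<bullet> (R *v a)"
    unfolding cov[symmetric] covariance_self by (rule integral_nonneg_AE) simp
  then show "0 \<le> a \<bullet> (correlation_matrix M Y *v a)" by (simp add: R_def)
  have "standard_gaussian M (standardized M Y) R"
  proof
    have [measurable]: "(\<lambda>x. Y x $ i) \<in> borel_measurable M" for i
      using gaussian_vector_component[OF Y] by (simp add: gaussian_var_def)
    show "standardized M Y \<in> borel_measurable M"
    proof (rule borel_measurable_euclidean_space[THEN iffD2], rule ballI)
      fix b :: "real ^ 'b" assume "b \<in> Basis"
      then obtain i where "b = axis i 1" by (auto simp: Basis_vec_def)
      then show "(\<lambda>x. standardized M Y x \<bullet> b) \<in> borel_measurable M"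
        by (simp add: standardized_def inner_axis)
    qed
    have "c i j = c j i" for i j by (simp add: c_def covariance_def mult.commute)
    then show "transpose R = R" by (simp add: vec_eq_iff transpose_def R mult.commute)
    show "R $ i $ i = 1" for i using pos[of i] by (simp add: R)
    show "integrable M (\<lambda>x. exp (a \<bullet> standardized M Y x))" for a
      using gaussian_var_moments(3)[OF gauss] by (simp add: X exp_diff)
    show "expectation (\<lambda>x. exp (a \<bullet> standardized M Y x)) = exp (a \<bullet> (R *v a) / 2)" for a
      using gaussian_var_moments(4)[OF gauss] by (simp add: X exp_diff mean cov exp_add)
  qed
  then show "standard_gaussian M (standardized M Y) (correlation_matrix M Y)" by (simp add: R_def)
qed

section \<open>From the orthant asymptotics to the tail dependence function\<close>

lemma Min_range_mult_nonpos:
  fixes f :: "'n :: finite \<Rightarrow> real"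
  assumes "c \<le> 0"
  shows "(MIN i. f i * c) = (MAX i. f i) * c"
proof (rule Min_eqI)
  show "(MAX i. f i) * c \<le> y" if "y \<in> range (\<lambda>i. f i * c)" for y
    using that assms by (auto intro!: mult_right_mono_neg)
  have "(MAX i. f i) \<in> range f" by (rule Max_in) auto
  then obtain i where "(MAX i. f i) = f i" by blast
  then show "(MAX i. f i) * c \<in> range (\<lambda>i. f i * c)" by (metis rangeI)
qed simp

theorem proposition2:
  fixes M :: "'a measure" and Y :: "'a \<Rightarrow> real ^ 'n"
    and R :: "real ^ 'n ^ 'n" and C :: "real ^ 'n \<Rightarrow> real"
  assumes "prob_space M"
    and "gaussian_vector M Y"
    and "nonconstant_components M Y"
    and "correlation_matrix M Y = R"
    and "copula_of M Y C"
    and "det R \<noteq> 0"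
  shows "\<forall>lam :: real ^ 'n. (\<forall>i. lam $ i > 0) \<longrightarrow>
    (\<exists>l. (tail_quotient C lam \<longlongrightarrow> l) (at_right 0)) \<and>
    (\<exists>w. is_arg_min (\<lambda>v. v \<bullet> (scaled_matrix R lam *v v)) (\<lambda>v. v \<in> prob_simplex) w \<and>
      weak_lower_tail_dependence C lam =
        (MAX i. lam $ i) * (w \<bullet> (scaled_matrix R lam *v w)))"
proof (intro allI impI)
  fix lam :: "real ^ 'n"
  assume "\<forall>i. lam $ i > 0"
  then have lam: "0 < lam $ i" for i by blast
  interpret prob_space M by fact
  define X where "X = standardized M Y"
  interpret standard_gaussian M X R
    unfolding X_def assms(4)[symmetric] by (intro standard_gaussian_standardized assms)
  have psd: "0 \<le> a \<bullet> (R *v a)" for a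
    unfolding assms(4)[symmetric] by (intro correlation_matrix_semidefinite assms)
  have pd: "0 < a \<bullet> (R *v a)" if "a \<noteq> 0" for a
  proof -
    have "R *v a \<noteq> 0"
      using that assms(6) invertible_det_nz[of R] matrix_left_invertible_ker[of R]
      by (auto simp: invertible_def)
    then have "a \<bullet> (R *v a) \<noteq> 0"
      using semidefinite_null_vector[OF transpose_R psd] by blast
    then show ?thesis using psd[of a] by simp
  qed

  define \<mu> where "\<mu> i = expectation (\<lambda>x. Y x $ i)" for i
  define s where "s i = sqrt (covariance M (\<lambda>x. Y x $ i) (\<lambda>x. Y x $ i))" for i
  note component = gaussian_vector_component[OF assms(2)]
  have nonconst: "\<not> (\<exists>c. AE x in M. Y x $ i = c)" for i
    using assms(3) unfolding nonconstant_components_def by blast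
  have s: "0 < s i" for i
    using nonconstant_gaussian_var(1)[OF component nonconst] by (simp add: s_def)
  \<comment> \<open>The levels are chosen so that the margins equal \<open>u powr (lam $ i)\<close>
    with \<open>L = - ln u\<close>; the defining identity of the copula then evaluates
    \<open>C\<close> at the point needed.\<close>
  have "\<exists>y. \<forall>i. prob {x \<in> space M. Y x $ i \<le> y i} = exp (- (lam $ i * L))" if "0 < L" for L
    using lam that
    by (intro choice allI nonconstant_gaussian_var(2)[OF component nonconst]) auto
  then obtain y where y: "prob {x \<in> space M. Y x $ i \<le> y L i} = exp (- (lam $ i * L))"
    if "0 < L" for L i
    by metis
  define q where "q L = (\<chi> i. (\<mu> i - y L i) / s i)" for L
  have X_le: "X x $ i \<le> - q L $ i \<longleftrightarrow> Y x $ i \<le> y L i" for x L i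
    using s[of i] unfolding minus_divide_left X_def standardized_def q_def
    by (simp add: \<mu>_def s_def divide_le_cancel flip: minus_divide_left) (auto simp: field_simps)
  define P where "P L = prob {x \<in> space M. \<forall>i. X x $ i \<le> - q L $ i}" for L
  have C: "C (\<chi> i. exp (- (lam $ i * L))) = P L" if "0 < L" for L
  proof -
    have "prob {x \<in> space M. \<forall>i. Y x $ i \<le> (\<chi> i. y L i) $ i}
        = C (\<chi> i. prob {x \<in> space M. Y x $ i \<le> (\<chi> i. y L i) $ i})"
      using assms(5) unfolding copula_of_def by blast
    then show ?thesis using y[OF that] by (simp add: P_def X_le)
  qed

  obtain w where w: "is_arg_min (\<lambda>v. v \<bullet> (scaled_matrix R lam *v v)) (\<lambda>v. v \<in> prob_simplex) w"
    using ex_arg_min_prob_simplex by blast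
  define m where "m = w \<bullet> (scaled_matrix R lam *v w)"
  have "prob {x \<in> space M. X x $ i \<le> - q L $ i} = exp (- (lam $ i * L))" if "0 < L" for L i
    using y[OF that] by (simp add: X_le)
  note asymp = orthant_log_asymptotics[OF lam pd w this]
  have m: "0 < m" using asymp(1) by (simp add: m_def)
  have "((\<lambda>L. - ln (P L) / L) \<longlongrightarrow> 1 / m) at_top"
    using asymp(2) by (simp add: P_def m_def)
  moreover have "filterlim (\<lambda>u. - ln u) at_top (at_right (0 :: real))"
    by real_asymp
  ultimately have "((\<lambda>u. - ln (P (- ln u)) / (- ln u)) \<longlongrightarrow> 1 / m) (at_right 0)"
    by (rule filterlim_compose)
  \<comment> \<open>The tail quotient is \<open>(MAX i. lam $ i)\<close> divided by
    \<open>ln P / ln u\<close>, so the limit \<open>1 / m\<close> enters as a reciprocal.\<close>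
  then have "((\<lambda>u. (MAX i. lam $ i) / (- ln (P (- ln u)) / (- ln u)))
      \<longlongrightarrow> (MAX i. lam $ i) / (1 / m)) (at_right 0)"
    by (rule tendsto_divide[OF tendsto_const]) (use m in simp)
  moreover have "\<forall>\<^sub>F u in at_right 0.
      (MAX i. lam $ i) / (- ln (P (- ln u)) / (- ln u)) = tail_quotient C lam u"
  proof -
    have "\<forall>\<^sub>F u in at_right (0 :: real). 0 < u \<and> u < 1"
      by (auto simp: eventually_at_right_field intro: exI[of _ 1])
    then show ?thesis
    proof eventually_elim
      case (elim u)
      then have "ln u < 0" by simp
      have "(\<chi> i. u powr lam $ i) = (\<chi> i. exp (- (lam $ i * (- ln u))))"
        using elim by (simp add: powr_def vec_eq_iff)
      then have "C (\<chi> i. u powr lam $ i) = P (- ln u)"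
        using C[of "- ln u"] \<open>ln u < 0\<close> by simp
      \<comment> \<open>Since \<open>ln u\<close> is negative, the minimum of
        \<open>lam $ i * ln u\<close> is attained at the largest \<open>lam $ i\<close>.\<close>
      moreover have "(MIN i. ln (u powr lam $ i)) = (MAX i. lam $ i) * ln u"
        using elim \<open>ln u < 0\<close> by (simp add: ln_powr Min_range_mult_nonpos)
      ultimately show ?case by (simp add: tail_quotient_def)
    qed
  qed
  ultimately have lim: "(tail_quotient C lam \<longlongrightarrow> (MAX i. lam $ i) * m) (at_right 0)"
    by (simp add: tendsto_cong)
  then have "weak_lower_tail_dependence C lam = (MAX i. lam $ i) * m"
    unfolding weak_lower_tail_dependence_def by (intro tendsto_Lim) auto
  then show "(\<exists>l. (tail_quotient C lam \<longlongrightarrow> l) (at_right 0)) \<and>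
    (\<exists>w. is_arg_min (\<lambda>v. v \<bullet> (scaled_matrix R lam *v v)) (\<lambda>v. v \<in> prob_simplex) w \<and>
      weak_lower_tail_dependence C lam =
        (MAX i. lam $ i) * (w \<bullet> (scaled_matrix R lam *v w)))"
    using lim w unfolding m_def by blast
qed

end
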